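(* Let an \emph{$\mathrm{SL}_2$-tiling over $\mathbb{Z}$} be a bi-infinite array $M=(m_{i,j})_{i,j\in\mathbb{Z}}$ of integers such that $m_{i,j}m_{i+1,j+1}-m_{i,j+1}m_{i+1,j}=1$ for all $i,j\in\mathbb{Z}$. Call an entry $m_{i,j}$ \emph{wild} if \[ \det\begin{pmatrix} m_{i-1,j-1} & m_{i-1,j} & m_{i-1,j+1}\\ m_{i,j-1} & m_{i,j} & m_{i,j+1}\\ m_{i+1,j-1} & m_{i+1,j} & m_{i+1,j+1} \end{pmatrix}\neq 0, \] and define the \emph{wild density} of $M$ as \[ \limsup_{r\to\infty}\frac{\#\{(i,j)\in\mathbb{Z}^2:\ i^2+j^2\le r^2,\ m_{i,j}\text{ is wild}\}}{\#\{(i,j)\in\mathbb{Z}^2:\ i^2+j^2\le r^2\}}. \] Then every $\mathrm{SL}_2$-tiling over $\mathbb{Z}$ has wild density at most $\tfrac25$, and this value is attained. Specifically, let $L=\{(i,j)\in\mathbb{Z}^2: j+3i\equiv 0 \pmod{10}\}$, choose arbitrary nonzero integers $a_{i,j}$ for $(i,j)\in L$, and set $m_{i,j}=a_{i,j}$ for $(i,j)\in L$ and $m_{i,j}=\sin\!\big(\pi(i-j)/2\big)\in\{0,1,-1\}$ for $(i,j)\notin L$. Then $M=(m_{i,j})$ is an $\mathrm{SL}_2$-tiling over $\mathbb{Z}$ with wild density exactly $\tfrac25$ (every zero entry of $M$ being wild).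
   Context: A tiling is called tame if no entry is wild, and wild otherwise. The maximum in the theorem is over all $\mathrm{SL}_2$-tilings with integer entries. *)

theory Defs
  imports "HOL-Analysis.Analysis" "HOL-Number_Theory.Cong"
begin

definition SL2_tiling :: "(int \<Rightarrow> int \<Rightarrow> int) \<Rightarrow> bool" where
  "SL2_tiling m \<longleftrightarrow>
     (\<forall>i j. m i j * m (i + 1) (j + 1) - m i (j + 1) * m (i + 1) j = 1)"

definition neighbourhood :: "(int \<Rightarrow> int \<Rightarrow> int) \<Rightarrow> int \<Rightarrow> int \<Rightarrow> int^3^3" where
  "neighbourhood m i j = vector
     [vector [m (i - 1) (j - 1), m (i - 1) j, m (i - 1) (j + 1)],
      vector [m i       (j - 1), m i       j, m i       (j + 1)],
      vector [m (i + 1) (j - 1), m (i + 1) j, m (i + 1) (j + 1)]]"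

definition wild :: "(int \<Rightarrow> int \<Rightarrow> int) \<Rightarrow> int \<Rightarrow> int \<Rightarrow> bool" where
  "wild m i j \<longleftrightarrow> det (neighbourhood m i j) \<noteq> 0"

definition lattice_disc :: "real \<Rightarrow> (int \<times> int) set" where
  "lattice_disc r = {(i, j). real_of_int (i\<^sup>2 + j\<^sup>2) \<le> r\<^sup>2}"

text \<open>The radius ranges over the reals. The limsup is taken in the extended reals, where it
  always exists; the quotients lie between 0 and 1, since every disc contains the origin.\<close>

definition wild_density :: "(int \<Rightarrow> int \<Rightarrow> int) \<Rightarrow> ereal" where
  "wild_density m = Limsup at_top (\<lambda>r::real.
     ereal (real (card {(i, j) \<in> lattice_disc r. wild m i j}) / real (card (lattice_disc r))))"

definition L10 :: "(int \<times> int) set" where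
  "L10 = {(i, j). [j + 3 * i = 0] (mod 10)}"

definition sine_entry :: "int \<Rightarrow> int \<Rightarrow> real" where
  "sine_entry i j = sin (pi * real_of_int (i - j) / 2)"

text \<open>Only the values of \<open>a\<close> on \<^const>\<open>L10\<close> matter. The floor serves solely to turn
  \<^const>\<open>sine_entry\<close>, whose values are 0, 1 and -1, into an integer.\<close>

definition sine_tiling :: "(int \<Rightarrow> int \<Rightarrow> int) \<Rightarrow> int \<Rightarrow> int \<Rightarrow> int" where
  "sine_tiling a i j = (if (i, j) \<in> L10 then a i j else \<lfloor>sine_entry i j\<rfloor>)"

end

theory Submission
  imports Defs "HOL-Real_Asymp.Real_Asymp"
begin

text \<open>By Dodgson condensation a wild entry is zero, its four edge neighbours are then \<open>\<plusminus>1\<close>, and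
  the \<open>3 \<times> 3\<close> determinant is the sum of the four corner neighbours, so at least one corner
  neighbour is nonzero. Hence a \<open>2 \<times> 2\<close> block contains at most two wild entries, and every wild
  entry lies in some block in which it is the only one. Giving each block weight \<open>n + [n = 1] \<le> 2\<close>,
  where \<open>n\<close> is its number of wild entries, every wild entry collects weight at least \<open>4 + 1\<close>,
  so the wild density is at most \<open>2/5\<close>. In the sine tiling the entry at \<open>(i, j)\<close> is wild exactly
  if \<open>j + 3 * i\<close> is even and not divisible by 10, which gives four wild entries in any ten
  consecutive entries of a row.\<close>

section \<open>Lattice points in discs\<close>

text \<open>Puts the disc inside the Euclidean plane, where the triangle inequality and the area of
  a ball are available. The sign condition matters: \<open>lattice_disc r\<close> depends only on
  the square of \<open>r\<close>, whereas a norm ball of negative radius is empty.\<close>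

lemma mem_lattice_disc_iff_norm:
  assumes "0 \<le> r"
  shows "(i, j) \<in> lattice_disc r \<longleftrightarrow> norm (real_of_int i, real_of_int j) \<le> r"
proof -
  have "norm (real_of_int i, real_of_int j) \<le> r \<longleftrightarrow> sqrt (real_of_int (i\<^sup>2 + j\<^sup>2)) \<le> sqrt (r\<^sup>2)"
    using assms by (simp add: norm_Pair)
  then show ?thesis
    unfolding real_sqrt_le_iff by (simp add: lattice_disc_def)
qed

lemma lattice_disc_add:
  assumes "(i, j) \<in> lattice_disc r" "0 \<le> r"
    and "real_of_int \<bar>a\<bar> + real_of_int \<bar>b\<bar> \<le> s"
  shows "(i, j) + (a, b) \<in> lattice_disc (r + s)"
proof -
  have "norm (real_of_int (i + a), real_of_int (j + b))
      = norm ((real_of_int i, real_of_int j) + (real_of_int a, real_of_int b))"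
    by simp
  also have "\<dots> \<le> norm (real_of_int i, real_of_int j) + norm (real_of_int a, real_of_int b)"
    by (rule norm_triangle_ineq)
  also have "\<dots> \<le> r + s"
    using assms mem_lattice_disc_iff_norm[of r i j] norm_Pair_le[of "real_of_int a" "real_of_int b"]
    by (intro add_mono) auto
  finally show ?thesis
    using assms by (simp add: mem_lattice_disc_iff_norm)
qed

lemma finite_lattice_disc: "finite (lattice_disc r)"
proof (rule finite_subset)
  show "lattice_disc r \<subseteq> {-\<lceil>\<bar>r\<bar>\<rceil>..\<lceil>\<bar>r\<bar>\<rceil>} \<times> {-\<lceil>\<bar>r\<bar>\<rceil>..\<lceil>\<bar>r\<bar>\<rceil>}"
  proof
    fix c assume c: "c \<in> lattice_disc r"
    obtain i j where ij: "c = (i, j)" by fastforce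
    have "(real_of_int i)\<^sup>2 + (real_of_int j)\<^sup>2 \<le> r\<^sup>2"
      using c by (simp add: lattice_disc_def ij)
    then have "(real_of_int i)\<^sup>2 \<le> r\<^sup>2" "(real_of_int j)\<^sup>2 \<le> r\<^sup>2"
      using zero_le_power2[of "real_of_int i"] zero_le_power2[of "real_of_int j"] by linarith+
    then have "real_of_int \<bar>i\<bar> \<le> \<bar>r\<bar>" "real_of_int \<bar>j\<bar> \<le> \<bar>r\<bar>"
      by (simp_all add: abs_le_square_iff)
    then have "\<bar>i\<bar> \<le> \<lceil>\<bar>r\<bar>\<rceil>" "\<bar>j\<bar> \<le> \<lceil>\<bar>r\<bar>\<rceil>"
      by linarith+
    then show "c \<in> {-\<lceil>\<bar>r\<bar>\<rceil>..\<lceil>\<bar>r\<bar>\<rceil>} \<times> {-\<lceil>\<bar>r\<bar>\<rceil>..\<lceil>\<bar>r\<bar>\<rceil>}"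
      by (auto simp: ij)
  qed
qed simp

text \<open>Gauss's area argument: attach to each lattice point of the disc the unit square with
  that point as lower left corner. The union has area equal to the number of points and lies between
  two concentric balls.\<close>

lemma card_lattice_disc_bounds:
  assumes "2 \<le> r"
  shows "pi * (r - 2)\<^sup>2 \<le> card (lattice_disc r)" and "card (lattice_disc r) \<le> pi * (r + 2)\<^sup>2"
proof -
  define cell :: "int \<times> int \<Rightarrow> (real \<times> real) set" where
    "cell = (\<lambda>(i, j). {real_of_int i..<real_of_int i + 1} \<times> {real_of_int j..<real_of_int j + 1})"
  define U where "U = (\<Union>c\<in>lattice_disc r. cell c)"
  have cell_sets: "cell c \<in> sets lborel" for c
    by (auto simp: cell_def split: prod.split intro!: borel_Times)
  have cell_emeasure: "emeasure lborel (cell c) = 1" for c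
    by (cases c) (simp add: cell_def lborel_prod[symmetric] lborel.emeasure_pair_measure_Times)
  \<comment> \<open>Half-open squares make the floors pick out the only cell containing a point;
    disjointness and both inclusions rest on this.\<close>
  have mem_cell: "(x, y) \<in> cell c \<longleftrightarrow> c = (\<lfloor>x\<rfloor>, \<lfloor>y\<rfloor>)" for x y c
    by (cases c) (auto simp: cell_def; linarith)
  have "disjoint_family_on cell (lattice_disc r)"
    unfolding disjoint_family_on_def using mem_cell by fastforce
  then have measure_U: "measure lborel U = card (lattice_disc r)"
    unfolding U_def
    by (subst measure_finite_Union)
      (use cell_sets in \<open>auto simp: finite_lattice_disc cell_emeasure measure_def\<close>)
  have U_fmeasurable: "U \<in> fmeasurable lborel"
    unfolding U_def
    by (intro fmeasurable.finite_UN finite_lattice_disc fmeasurableI)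
      (use cell_sets in \<open>auto simp: cell_emeasure\<close>)
  \<comment> \<open>The constant 2 is a crude bound for the diameter of a unit square.\<close>
  have floor_dist: "norm ((x, y) - (real_of_int \<lfloor>x\<rfloor>, real_of_int \<lfloor>y\<rfloor>)) \<le> 2" for x y :: real
  proof -
    have "norm ((x, y) - (real_of_int \<lfloor>x\<rfloor>, real_of_int \<lfloor>y\<rfloor>))
        \<le> \<bar>x - real_of_int \<lfloor>x\<rfloor>\<bar> + \<bar>y - real_of_int \<lfloor>y\<rfloor>\<bar>"
      using norm_Pair_le by (metis diff_Pair real_norm_def)
    also have "\<dots> \<le> 2"
      by linarith
    finally show ?thesis .
  qed
  have lower: "cball 0 (r - 2) \<subseteq> U"
  proof
    fix p :: "real \<times> real" assume p: "p \<in> cball 0 (r - 2)"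
    obtain x y where xy: "p = (x, y)" by fastforce
    have "norm (real_of_int \<lfloor>x\<rfloor>, real_of_int \<lfloor>y\<rfloor>) \<le> r"
      using p norm_triangle_sub[of "(real_of_int \<lfloor>x\<rfloor>, real_of_int \<lfloor>y\<rfloor>)" p]
        floor_dist[of x y] norm_minus_commute[of p "(real_of_int \<lfloor>x\<rfloor>, real_of_int \<lfloor>y\<rfloor>)"]
      unfolding xy mem_cball_0 by linarith
    then show "p \<in> U"
      using assms by (auto simp: U_def xy mem_cell mem_lattice_disc_iff_norm)
  qed
  have upper: "U \<subseteq> cball 0 (r + 2)"
  proof
    fix p assume p: "p \<in> U"
    obtain x y where xy: "p = (x, y)" by fastforce
    have "norm (real_of_int \<lfloor>x\<rfloor>, real_of_int \<lfloor>y\<rfloor>) \<le> r"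
      using p assms by (auto simp: U_def xy mem_cell mem_lattice_disc_iff_norm)
    then show "p \<in> cball 0 (r + 2)"
      using norm_triangle_sub[of p "(real_of_int \<lfloor>x\<rfloor>, real_of_int \<lfloor>y\<rfloor>)"] floor_dist[of x y]
      unfolding xy mem_cball_0 by linarith
  qed
  have content: "measure lborel (cball (0 :: real \<times> real) s) = pi * s\<^sup>2" if "0 \<le> s" for s
    using that by (simp add: content_cball unit_ball_vol_2 power2_eq_square)
  have "measure lborel (cball (0 :: real \<times> real) (r - 2)) \<le> measure lborel U"
    by (rule measure_mono_fmeasurable[OF lower _ U_fmeasurable]) simp
  then show "pi * (r - 2)\<^sup>2 \<le> card (lattice_disc r)"
    using assms by (simp add: content measure_U)
  have "measure lborel U \<le> measure lborel (cball (0 :: real \<times> real) (r + 2))"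
    using U_fmeasurable
    by (intro measure_mono_fmeasurable[OF upper] fmeasurable_compact) (auto simp: fmeasurableD)
  then show "card (lattice_disc r) \<le> pi * (r + 2)\<^sup>2"
    using assms by (simp add: content measure_U)
qed

text \<open>Both bounding quotients have leading coefficient \<open>pi\<close> above and below. This
  makes boundary effects of bounded width, with \<open>s\<close> of either sign, vanish in the
  densities.\<close>

lemma card_lattice_disc_shift_ratio:
  "((\<lambda>r. real (card (lattice_disc (r + s))) / real (card (lattice_disc r))) \<longlongrightarrow> 1) at_top"
proof (rule tendsto_sandwich)
  \<comment> \<open>From here on \<open>r - 2\<close> is positive and \<open>r + s\<close> is at
    least 2, as the area bounds require.\<close>
  have large: "\<forall>\<^sub>F r in at_top. max 3 (3 - s) \<le> r"
    by (rule eventually_ge_at_top)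
  show "\<forall>\<^sub>F r in at_top. (pi * (r + s - 2)\<^sup>2) / (pi * (r + 2)\<^sup>2)
      \<le> real (card (lattice_disc (r + s))) / real (card (lattice_disc r))"
    using large
  proof eventually_elim
    case (elim r)
    have "0 < pi * (r - 2)\<^sup>2"
      using elim by simp
    also have "\<dots> \<le> card (lattice_disc r)"
      using elim by (intro card_lattice_disc_bounds) simp
    finally show ?case
      using elim card_lattice_disc_bounds[of r] card_lattice_disc_bounds[of "r + s"]
      by (intro frac_le) auto
  qed
  show "\<forall>\<^sub>F r in at_top. real (card (lattice_disc (r + s))) / real (card (lattice_disc r))
      \<le> (pi * (r + s + 2)\<^sup>2) / (pi * (r - 2)\<^sup>2)"
    using large
  proof eventually_elim
    case (elim r)
    then show ?case
      using card_lattice_disc_bounds[of r] card_lattice_disc_bounds[of "r + s"]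
      by (intro frac_le) auto
  qed
  show "((\<lambda>r. (pi * (r + s - 2)\<^sup>2) / (pi * (r + 2)\<^sup>2)) \<longlongrightarrow> 1) at_top"
    by real_asymp
  show "((\<lambda>r. (pi * (r + s + 2)\<^sup>2) / (pi * (r - 2)\<^sup>2)) \<longlongrightarrow> 1) at_top"
    by real_asymp
qed

text \<open>Substitution \<open>b = c - x\<close>. Writing membership in \<open>W\<close> as a
  factor gives all shifts \<open>x\<close> the common index set \<open>D\<close>, so that the sums
  can later be interchanged.\<close>

lemma sum_translate:
  fixes W D :: "'a :: ab_group_add set" and f :: "'a \<Rightarrow> nat"
  assumes "finite D" and "\<And>c. c \<in> W \<Longrightarrow> c - x \<in> D"
  shows "(\<Sum>b\<in>D. of_bool (b + x \<in> W) * f b) = (\<Sum>c\<in>W. f (c - x))"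
proof -
  have "(\<Sum>b\<in>D. of_bool (b + x \<in> W) * f b) = (\<Sum>b\<in>{b \<in> D. b + x \<in> W}. f b)"
    unfolding sum.inter_filter[OF assms(1)] by (rule sum.cong) simp_all
  also have "\<dots> = (\<Sum>c\<in>W. f (c - x))"
    by (rule sum.reindex_bij_witness[where i = "\<lambda>c. c - x" and j = "\<lambda>b. b + x"])
      (use assms(2) in auto)
  finally show ?thesis .
qed

section \<open>Wild entries\<close>

abbreviation wild_count :: "(int \<Rightarrow> int \<Rightarrow> int) \<Rightarrow> real \<Rightarrow> nat" where
  "wild_count m r \<equiv> card {(i, j) \<in> lattice_disc r. wild m i j}"

lemma det_neighbourhood:
  "det (neighbourhood m i j) =
     m (i - 1) (j - 1) * (m i j * m (i + 1) (j + 1) - m i (j + 1) * m (i + 1) j)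
   - m (i - 1) j * (m i (j - 1) * m (i + 1) (j + 1) - m i (j + 1) * m (i + 1) (j - 1))
   + m (i - 1) (j + 1) * (m i (j - 1) * m (i + 1) j - m i j * m (i + 1) (j - 1))"
  by (simp add: neighbourhood_def det_3 algebra_simps)

text \<open>These are the four corner minors of \<open>neighbourhood m i j\<close>, with normalised
  indices.\<close>

lemma SL2_tiling_blocks:
  assumes "SL2_tiling m"
  shows "m (i - 1) (j - 1) * m i j - m (i - 1) j * m i (j - 1) = 1"
    and "m (i - 1) j * m i (j + 1) - m (i - 1) (j + 1) * m i j = 1"
    and "m i (j - 1) * m (i + 1) j - m i j * m (i + 1) (j - 1) = 1"
    and "m i j * m (i + 1) (j + 1) - m i (j + 1) * m (i + 1) j = 1"
  using assms[unfolded SL2_tiling_def, rule_format, of "i - 1" "j - 1"]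
    assms[unfolded SL2_tiling_def, rule_format, of "i - 1" j]
    assms[unfolded SL2_tiling_def, rule_format, of i "j - 1"]
    assms[unfolded SL2_tiling_def, rule_format, of i j]
  by simp_all

lemma wild_imp_zero:
  assumes "SL2_tiling m" "wild m i j"
  shows "m i j = 0"
proof -
  note blocks = SL2_tiling_blocks[OF assms(1), of i j]
  \<comment> \<open>Dodgson's identity for the matrix with rows \<open>a b c\<close>,
    \<open>d e f\<close>, \<open>g h k\<close>: centre times determinant equals a difference of
    products of corner minors, here \<open>1 * 1 - 1 * 1\<close>.\<close>
  have dodgson: "e * (a * (e * k - f * h) - b * (d * k - f * g) + c * (d * h - e * g))
      = (a * e - b * d) * (e * k - f * h) - (b * f - c * e) * (d * h - e * g)"
    for a b c d e f g h k :: int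
    by algebra
  have "m i j * det (neighbourhood m i j) = 0"
    using blocks unfolding det_neighbourhood dodgson by simp
  then show ?thesis
    using assms(2) by (simp add: wild_def)
qed

lemma zero_entry_neighbours:
  assumes "SL2_tiling m" "m i j = 0"
  shows "m (i - 1) j \<noteq> 0" "m (i + 1) j \<noteq> 0" "m i (j - 1) \<noteq> 0" "m i (j + 1) \<noteq> 0"
  using SL2_tiling_blocks[OF assms(1), of i j] assms(2) by auto

text \<open>Every nonvanishing term is a corner times the two edge neighbours from the diagonally
  opposite block. The block equations fix these products as 1 or -1, which cancels the sign of the
  term.\<close>

lemma det_neighbourhood_zero_entry:
  assumes "SL2_tiling m" "m i j = 0"
  shows "det (neighbourhood m i j) =
    m (i - 1) (j - 1) + m (i - 1) (j + 1) + m (i + 1) (j - 1) + m (i + 1) (j + 1)"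
proof -
  have b: "m (i - 1) j * m i (j - 1) = -1" "m (i - 1) j * m i (j + 1) = 1"
    "m i (j - 1) * m (i + 1) j = 1" "m i (j + 1) * m (i + 1) j = -1"
    using SL2_tiling_blocks[OF assms(1), of i j] assms(2) by auto
  have "det (neighbourhood m i j) =
     - m (i - 1) (j - 1) * (m i (j + 1) * m (i + 1) j)
     - (m (i - 1) j * m i (j - 1)) * m (i + 1) (j + 1)
     + (m (i - 1) j * m i (j + 1)) * m (i + 1) (j - 1)
     + m (i - 1) (j + 1) * (m i (j - 1) * m (i + 1) j)"
    unfolding det_neighbourhood assms(2) by algebra
  then show ?thesis
    unfolding b by simp
qed

lemma wild_edge_neighbours:
  assumes "SL2_tiling m" "wild m i j"
  shows "\<not> wild m (i - 1) j" "\<not> wild m (i + 1) j" "\<not> wild m i (j - 1)" "\<not> wild m i (j + 1)"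
  using zero_entry_neighbours[OF assms(1) wild_imp_zero[OF assms]] wild_imp_zero[OF assms(1)]
  by blast+

lemma wild_corner_neighbour:
  assumes "SL2_tiling m" "wild m i j"
  shows "\<not> wild m (i - 1) (j - 1) \<or> \<not> wild m (i - 1) (j + 1)
    \<or> \<not> wild m (i + 1) (j - 1) \<or> \<not> wild m (i + 1) (j + 1)"
proof (rule ccontr)
  assume "\<not> ?thesis"
  then have "det (neighbourhood m i j) = 0"
    by (simp add: det_neighbourhood_zero_entry[OF assms(1)] wild_imp_zero[OF assms(1)] assms(2))
  then show False
    using assms(2) by (simp add: wild_def)
qed

text \<open>Double counting of pairs of a wild entry and a block containing it. A block is indexed
  by its top left corner \<open>b\<close>, so \<open>c\<close> lies in the blocks
  \<open>c - x\<close> with \<open>x\<close> in \<open>X\<close>; the radius \<open>r + 2\<close>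
  leaves room for these corners.\<close>

lemma wild_count_upper:
  assumes tiling: "SL2_tiling m" and "0 \<le> r"
  shows "5 * wild_count m r \<le> 2 * card (lattice_disc (r + 2))"
proof -
  define wild_at where "wild_at = (\<lambda>(i, j). wild m i j)"
  define W where "W = {c \<in> lattice_disc r. wild_at c}"
  define D where "D = lattice_disc (r + 2)"
  define X :: "(int \<times> int) set" where "X = {(0, 0), (0, 1), (1, 0), (1, 1)}"
  define n :: "int \<times> int \<Rightarrow> nat" where "n = (\<lambda>b. \<Sum>x\<in>X. of_bool (wild_at (b + x)))"
  define e :: "int \<times> int \<Rightarrow> nat" where "e = (\<lambda>b. of_bool (n b = 1))"
  have "finite D"
    by (simp add: D_def finite_lattice_disc)
  have shift: "c - x \<in> D" if "c \<in> W" "x \<in> X" for c x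
    using lattice_disc_add[of "fst c" "snd c" r "- fst x" "- snd x" 2] that \<open>0 \<le> r\<close>
    by (cases c) (auto simp: D_def W_def X_def)
  have n_eq: "n (i, j) = of_bool (wild m i j) + of_bool (wild m i (j + 1))
      + of_bool (wild m (i + 1) j) + of_bool (wild m (i + 1) (j + 1))" for i j
    by (simp add: n_def X_def wild_at_def)
  \<comment> \<open>This product is the weight \<open>n + [n = 1]\<close>, because
    \<open>e b\<close> is 1 only if \<open>n b = 1\<close>.\<close>
  have n_le: "n b * (1 + e b) \<le> 2" for b
  proof -
    obtain i j where b: "b = (i, j)" by fastforce
    \<comment> \<open>Each of \<open>(i, j)\<close> and \<open>(i + 1, j + 1)\<close> is an edge
      neighbour of both other entries, so wild entries occur on at most one diagonal of the
      block.\<close>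
    have "n b \<le> 2"
      using wild_edge_neighbours[OF tiling, of i j] wild_edge_neighbours[OF tiling, of "i + 1" "j + 1"]
      by (auto simp: n_eq b)
    then show ?thesis
      by (cases "n b = 1") (auto simp: e_def)
  qed
  have lonely: "1 \<le> (\<Sum>x\<in>X. e (c - x))" if "c \<in> W" for c
  proof -
    obtain i j where c: "c = (i, j)" by fastforce
    have "wild m i j"
      using that by (simp add: W_def wild_at_def c)
    note nb = wild_edge_neighbours[OF tiling this] wild_corner_neighbour[OF tiling this]
    \<comment> \<open>The block reaching from \<open>c\<close> to a corner neighbour that is not
      wild: its other two entries are edge neighbours of \<open>c\<close>.\<close>
    then have "n (i, j) = 1 \<or> n (i, j - 1) = 1 \<or> n (i - 1, j) = 1 \<or> n (i - 1, j - 1) = 1"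
      using \<open>wild m i j\<close> by (auto simp: n_eq)
    then show ?thesis
      by (auto simp: X_def e_def c simp del: sum_of_bool_eq)
  qed
  have "5 * card W = (\<Sum>c\<in>W. 4 + 1)"
    by simp
  also have "\<dots> \<le> (\<Sum>c\<in>W. \<Sum>x\<in>X. 1 + e (c - x))"
  proof (rule sum_mono)
    fix c assume "c \<in> W"
    have "card X = 4"
      by (simp add: X_def)
    then show "4 + 1 \<le> (\<Sum>x\<in>X. 1 + e (c - x))"
      using lonely[OF \<open>c \<in> W\<close>] by (simp only: sum.distrib) simp
  qed
  also have "\<dots> = (\<Sum>x\<in>X. \<Sum>c\<in>W. 1 + e (c - x))"
    by (rule sum.swap)
  also have "\<dots> = (\<Sum>x\<in>X. \<Sum>b\<in>D. of_bool (b + x \<in> W) * (1 + e b))"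
    by (intro sum.cong[OF refl] sum_translate[OF \<open>finite D\<close>, symmetric] shift)
  \<comment> \<open>Admitting wild entries outside the disc only adds terms, and completes the inner
    count to \<open>n b\<close>.\<close>
  also have "\<dots> \<le> (\<Sum>x\<in>X. \<Sum>b\<in>D. of_bool (wild_at (b + x)) * (1 + e b))"
    by (intro sum_mono mult_right_mono) (auto simp: W_def)
  also have "\<dots> = (\<Sum>b\<in>D. n b * (1 + e b))"
    unfolding n_def sum_distrib_right by (rule sum.swap)
  also have "\<dots> \<le> (\<Sum>b\<in>D. 2)"
    by (intro sum_mono n_le)
  also have "W = {(i, j) \<in> lattice_disc r. wild m i j}"
    by (auto simp: W_def wild_at_def)
  finally show ?thesis
    by (simp add: D_def mult.commute)
qed

lemma wild_density_le:
  assumes "SL2_tiling m"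
  shows "wild_density m \<le> ereal (2 / 5)"
proof -
  let ?N = "\<lambda>r. real (card (lattice_disc r))"
  have "\<forall>\<^sub>F r in at_top. ereal (real (wild_count m r) / ?N r) \<le> ereal (2 / 5 * (?N (r + 2) / ?N r))"
    using eventually_ge_at_top[of "0 :: real"]
  proof eventually_elim
    case (elim r)
    have "real (wild_count m r) \<le> 2 / 5 * ?N (r + 2)"
      using wild_count_upper[OF assms elim] by linarith
    then have "real (wild_count m r) / ?N r \<le> 2 / 5 * ?N (r + 2) / ?N r"
      by (rule divide_right_mono) simp
    then show ?case
      by simp
  qed
  then have "wild_density m \<le> Limsup at_top (\<lambda>r. ereal (2 / 5 * (?N (r + 2) / ?N r)))"
    unfolding wild_density_def by (rule Limsup_mono)
  also have "\<dots> = ereal (2 / 5 * 1)"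
    by (intro lim_imp_Limsup tendsto_ereal tendsto_mult tendsto_const card_lattice_disc_shift_ratio) simp
  finally show ?thesis
    by simp
qed

section \<open>The sine tiling\<close>

text \<open>The sine has period 4 in \<open>i - j\<close>, which leaves four values to
  evaluate.\<close>

lemma sine_entry_eq:
  "sine_entry i j = (if even (i - j) then 0 else if (i - j) mod 4 = 1 then 1 else -1)"
proof -
  define k where "k = i - j"
  define q where "q = k div 4"
  have "sine_entry i j = sin (pi * real_of_int (k mod 4) / 2 + 2 * pi * real_of_int q)"
  proof -
    have "real_of_int k = 4 * real_of_int q + real_of_int (k mod 4)"
      unfolding q_def by (metis mult_div_mod_eq of_int_add of_int_mult of_int_numeral)
    then show ?thesis
      by (simp add: sine_entry_def k_def[symmetric] field_simps)
  qed
  also have "\<dots> = sin (pi * real_of_int (k mod 4) / 2)"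
    by (simp add: sin_add)
  finally have eq: "sine_entry i j = sin (pi * real_of_int (k mod 4) / 2)" .
  have "k mod 4 \<in> {0, 1, 2, 3}"
    by auto
  moreover have "even k \<longleftrightarrow> k mod 4 \<in> {0, 2}"
    by auto presburger+
  moreover have "sin (pi * 3 / 2) = -1"
    using sin_3over2_pi by (simp add: mult.commute)
  ultimately show ?thesis
    unfolding eq k_def[symmetric] by auto
qed

lemma sine_tiling_outside:
  assumes "(i, j) \<notin> L10"
  shows "sine_tiling a i j = (if even (i - j) then 0 else if (i - j) mod 4 = 1 then 1 else -1)"
  using assms floor_of_int[of "-1", where ?'a = real] by (simp add: sine_tiling_def sine_entry_eq)

lemma L10_iff: "(i, j) \<in> L10 \<longleftrightarrow> (j + 3 * i) mod 10 = 0"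
  by (simp add: L10_def cong_def)

text \<open>Since \<open>j + 3 * i\<close> and \<open>i - j\<close> have the same parity,
  \<open>L10\<close> avoids these positions: the values of \<open>a\<close> only replace zeros of
  the sine.\<close>

lemma sine_tiling_odd:
  assumes "odd (i - j)"
  shows "sine_tiling a i j = (if (i - j) mod 4 = 1 then 1 else -1)"
proof -
  have "(i, j) \<notin> L10"
    unfolding L10_iff using assms by presburger
  then show ?thesis
    using assms by (simp add: sine_tiling_outside)
qed

lemma sine_tiling_even_outside:
  assumes "even (i - j)" "(i, j) \<notin> L10"
  shows "sine_tiling a i j = 0"
  using assms by (simp add: sine_tiling_outside)

text \<open>In every block one diagonal has even \<open>i - j\<close>. Its ends differ by 4 or 2 in
  \<open>j + 3 * i\<close>, so at most one is in \<open>L10\<close> and their product is 0. The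
  other diagonal carries signs: opposite ones where their product is subtracted, equal ones where it
  is added.\<close>

lemma SL2_tiling_sine_tiling: "SL2_tiling (sine_tiling a)"
  unfolding SL2_tiling_def
proof (intro allI)
  fix i j
  let ?m = "sine_tiling a"
  show "?m i j * ?m (i + 1) (j + 1) - ?m i (j + 1) * ?m (i + 1) j = 1"
  proof (cases "even (i - j)")
    case True
    have "(i, j) \<notin> L10 \<or> (i + 1, j + 1) \<notin> L10"
      unfolding L10_iff by presburger
    then have "?m i j * ?m (i + 1) (j + 1) = 0"
      using True by (auto simp: sine_tiling_even_outside)
    moreover have "(i + 1 - j) mod 4 = 1 \<longleftrightarrow> (i - (j + 1)) mod 4 \<noteq> 1"
      using True by presburger
    ultimately show ?thesis
      using True by (auto simp: sine_tiling_odd)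
  next
    case False
    have "(i, j + 1) \<notin> L10 \<or> (i + 1, j) \<notin> L10"
      unfolding L10_iff by presburger
    then have "?m i (j + 1) * ?m (i + 1) j = 0"
      using False by (auto simp: sine_tiling_even_outside)
    then show ?thesis
      using False by (auto simp: sine_tiling_odd)
  qed
qed

context
  fixes a :: "int \<Rightarrow> int \<Rightarrow> int"
  assumes nonzero: "\<forall>(i, j) \<in> L10. a i j \<noteq> 0"
begin

lemma sine_tiling_zero_iff:
  "sine_tiling a i j = 0 \<longleftrightarrow> (j + 3 * i) mod 10 \<in> {2, 4, 6, 8}"
proof (cases "(i, j) \<in> L10")
  case True
  then show ?thesis
    using nonzero by (auto simp: sine_tiling_def L10_iff)
next
  case False
  have even_iff: "even t \<longleftrightarrow> t mod 10 \<in> {2, 4, 6, 8}" if "t mod 10 \<noteq> 0" for t :: int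
    using that by simp presburger
  have "even (i - j) \<longleftrightarrow> even (j + 3 * i)"
    by auto
  also have "\<dots> \<longleftrightarrow> (j + 3 * i) mod 10 \<in> {2, 4, 6, 8}"
    using False by (intro even_iff) (simp add: L10_iff)
  finally have "even (i - j) \<longleftrightarrow> (j + 3 * i) mod 10 \<in> {2, 4, 6, 8}" .
  then show ?thesis
    using False by (simp add: sine_tiling_outside)
qed

text \<open>Stepping to the four corners changes \<open>j + 3 * i\<close> by -4, -2, 2 and 4, that
  is, by each nonzero even residue modulo 10 once.\<close>

lemma sine_tiling_wild_iff:
  "wild (sine_tiling a) i j \<longleftrightarrow> (j + 3 * i) mod 10 \<in> {2, 4, 6, 8}"
proof
  assume "wild (sine_tiling a) i j"
  then show "(j + 3 * i) mod 10 \<in> {2, 4, 6, 8}"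
    using wild_imp_zero[OF SL2_tiling_sine_tiling] by (simp only: sine_tiling_zero_iff[symmetric])
next
  let ?m = "sine_tiling a"
  assume *: "(j + 3 * i) mod 10 \<in> {2, 4, 6, 8}"
  have det: "det (neighbourhood ?m i j) =
      ?m (i - 1) (j - 1) + ?m (i - 1) (j + 1) + ?m (i + 1) (j - 1) + ?m (i + 1) (j + 1)"
    using det_neighbourhood_zero_entry[OF SL2_tiling_sine_tiling] * sine_tiling_zero_iff by blast
  define t where "t = (j + 3 * i) mod 10"
  have corners:
    "?m (i - 1) (j - 1) = 0 \<longleftrightarrow> (t - 4) mod 10 \<in> {2, 4, 6, 8}"
    "?m (i - 1) (j + 1) = 0 \<longleftrightarrow> (t - 2) mod 10 \<in> {2, 4, 6, 8}"
    "?m (i + 1) (j - 1) = 0 \<longleftrightarrow> (t + 2) mod 10 \<in> {2, 4, 6, 8}"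
    "?m (i + 1) (j + 1) = 0 \<longleftrightarrow> (t + 4) mod 10 \<in> {2, 4, 6, 8}"
    unfolding sine_tiling_zero_iff t_def mod_diff_left_eq mod_add_left_eq
    by (simp_all add: algebra_simps)
  \<comment> \<open>Exactly one corner neighbour lies in \<^const>\<open>L10\<close>, so the sum cannot cancel.\<close>
  have "?m (i - 1) (j - 1) + ?m (i - 1) (j + 1) + ?m (i + 1) (j - 1) + ?m (i + 1) (j + 1) \<noteq> 0"
  proof -
    consider "t = 2" | "t = 4" | "t = 6" | "t = 8"
      using * unfolding t_def by blast
    then show ?thesis
      using corners by cases simp_all
  qed
  then show "wild ?m i j"
    by (simp add: wild_def det)
qed

text \<open>Along a row \<open>j + 3 * i\<close> grows by 1, so ten consecutive entries meet every
  residue once and four are wild. Such a window starts at each point of the smaller disc and stays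
  in the larger one; for a fixed offset \<open>k\<close> the wild entries reached are distinct,
  hence at most \<open>card W\<close>.\<close>

lemma wild_count_sine_tiling_lower:
  assumes "10 \<le> r"
  shows "4 * card (lattice_disc (r - 10)) \<le> 10 * wild_count (sine_tiling a) r"
proof -
  define wild_at where "wild_at = (\<lambda>(i, j). wild (sine_tiling a) i j)"
  define W where "W = {c \<in> lattice_disc r. wild_at c}"
  define D where "D = lattice_disc (r - 10)"
  have "finite W" "finite D"
    by (simp_all add: D_def W_def finite_lattice_disc)
  have sum_ten: "(\<Sum>k<10. f k) = f 0 + f 1 + f 2 + f 3 + f 4 + f 5 + f 6 + f 7 + f 8 + f 9"
    for f :: "nat \<Rightarrow> nat"
    by (simp add: eval_nat_numeral)
  have row: "(\<Sum>k<10. of_bool (wild_at (b + (0, int k)))) = (4 :: nat)" for b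
  proof -
    obtain i j where b: "b = (i, j)" by fastforce
    define t where "t = (j + 3 * i) mod 10"
    have shift: "(j + x + 3 * i) mod 10 = (t + x) mod 10" for x
      unfolding t_def by (simp add: mod_simps algebra_simps)
    have "0 \<le> t" "t < 10"
      by (simp_all add: t_def)
    then have "t \<in> {0, 1, 2, 3, 4} \<union> {5, 6, 7, 8, 9}"
      unfolding Un_iff by (cases "t < 5") (rule disjI1, simp, linarith, rule disjI2, simp, linarith)
    then have "(\<Sum>k<10. of_bool ((t + int k) mod 10 \<in> {2, 4, 6, 8})) = (4 :: nat)"
      unfolding sum_ten by (elim UnE insertE) simp_all
    then show ?thesis
      by (simp only: b add_Pair wild_at_def case_prod_conv sine_tiling_wild_iff add_0_right shift)
  qed
  have mem: "b + (0, int k) \<in> lattice_disc r" if "b \<in> D" "k < 10" for b k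
    using lattice_disc_add[of "fst b" "snd b" "r - 10" 0 "int k" 10] that assms
    by (simp add: D_def)
  have "4 * card D = (\<Sum>b\<in>D. \<Sum>k<10. of_bool (wild_at (b + (0, int k))))"
    unfolding row by simp
  also have "\<dots> = (\<Sum>k<10. \<Sum>b\<in>D. of_bool (wild_at (b + (0, int k))))"
    by (rule sum.swap)
  also have "\<dots> = (\<Sum>k<10. card {b \<in> D. wild_at (b + (0, int k))})"
    using \<open>finite D\<close> by (simp add: sum.If_cases of_bool_def Int_def)
  also have "\<dots> \<le> (\<Sum>k<(10 :: nat). card W)"
  proof (rule sum_mono)
    fix k :: nat assume "k \<in> {..<10}"
    then have "(\<lambda>b. b + (0, int k)) ` {b \<in> D. wild_at (b + (0, int k))} \<subseteq> W"
      using mem by (auto simp: W_def)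
    then show "card {b \<in> D. wild_at (b + (0, int k))} \<le> card W"
      using \<open>finite W\<close> by (intro card_inj_on_le) (auto simp: inj_on_def)
  qed
  also have "W = {(i, j) \<in> lattice_disc r. wild (sine_tiling a) i j}"
    by (auto simp: W_def wild_at_def)
  finally show ?thesis
    by (simp add: D_def)
qed

lemma wild_density_sine_tiling: "wild_density (sine_tiling a) = ereal (2 / 5)"
proof (rule antisym)
  let ?N = "\<lambda>r. real (card (lattice_disc r))"
  \<comment> \<open>The form \<open>r + (- 10)\<close> matches the shift \<open>r + s\<close> in
    \<open>card_lattice_disc_shift_ratio\<close>.\<close>
  have "ereal (2 / 5 * 1) = Limsup at_top (\<lambda>r. ereal (2 / 5 * (?N (r + (- 10)) / ?N r)))"
    by (intro lim_imp_Limsup[symmetric] tendsto_ereal tendsto_mult tendsto_const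
        card_lattice_disc_shift_ratio) simp
  also have "\<dots> \<le> wild_density (sine_tiling a)"
    unfolding wild_density_def
  proof (rule Limsup_mono)
    show "\<forall>\<^sub>F r in at_top. ereal (2 / 5 * (?N (r + (- 10)) / ?N r))
        \<le> ereal (real (wild_count (sine_tiling a) r) / ?N r)"
      using eventually_ge_at_top[of "10 :: real"]
    proof eventually_elim
      case (elim r)
      have "2 / 5 * ?N (r + (- 10)) \<le> real (wild_count (sine_tiling a) r)"
        using wild_count_sine_tiling_lower[OF elim] by simp
      then have "2 / 5 * ?N (r + (- 10)) / ?N r \<le> real (wild_count (sine_tiling a) r) / ?N r"
        by (rule divide_right_mono) simp
      then show ?case
        by simp
    qed
  qed
  finally show "ereal (2 / 5) \<le> wild_density (sine_tiling a)"
    by simp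
qed (rule wild_density_le[OF SL2_tiling_sine_tiling])

end

theorem theorem1:
  "(\<forall>m. SL2_tiling m \<longrightarrow> wild_density m \<le> ereal (2 / 5)) \<and>
   (\<exists>m. SL2_tiling m \<and> wild_density m = ereal (2 / 5)) \<and>
   (\<forall>a. (\<forall>(i, j) \<in> L10. a i j \<noteq> 0) \<longrightarrow>
      (\<forall>i j. (i, j) \<notin> L10 \<longrightarrow>
         sine_entry i j \<in> {0, 1, -1} \<and> real_of_int (sine_tiling a i j) = sine_entry i j) \<and>
      SL2_tiling (sine_tiling a) \<and>
      wild_density (sine_tiling a) = ereal (2 / 5) \<and>
      (\<forall>i j. sine_tiling a i j = 0 \<longrightarrow> wild (sine_tiling a) i j))"
proof (intro conjI)
  show "\<forall>m. SL2_tiling m \<longrightarrow> wild_density m \<le> ereal (2 / 5)"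
    by (simp add: wild_density_le)
  \<comment> \<open>The constant 1 is a simple admissible choice of nonzero values on
    \<open>L10\<close>.\<close>
  have "wild_density (sine_tiling (\<lambda>_ _. 1)) = ereal (2 / 5)"
    by (rule wild_density_sine_tiling) auto
  then show "\<exists>m. SL2_tiling m \<and> wild_density m = ereal (2 / 5)"
    using SL2_tiling_sine_tiling by blast
  show "\<forall>a. (\<forall>(i, j) \<in> L10. a i j \<noteq> 0) \<longrightarrow>
      (\<forall>i j. (i, j) \<notin> L10 \<longrightarrow>
         sine_entry i j \<in> {0, 1, -1} \<and> real_of_int (sine_tiling a i j) = sine_entry i j) \<and>
      SL2_tiling (sine_tiling a) \<and>
      wild_density (sine_tiling a) = ereal (2 / 5) \<and>
      (\<forall>i j. sine_tiling a i j = 0 \<longrightarrow> wild (sine_tiling a) i j)"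
    using SL2_tiling_sine_tiling wild_density_sine_tiling sine_tiling_zero_iff sine_tiling_wild_iff
    by (simp add: sine_tiling_outside sine_entry_eq)
qed

end
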